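(* Let $G$ be a strongly topological gyrogroup and let $H$ be a locally compact metrizable strong subgyrogroup of $G$. If the quotient space $G/H$ is sequential, then $G$ is also sequential.
   Context: All topological spaces are assumed Hausdorff. A gyrogroup is a nonempty set $G$ with a binary operation $\oplus$ such that: (G1) there is a unique $0\in G$ with $0\oplus a=a=a\oplus 0$ for all $a$; (G2) each $x\in G$ has a unique inverse $\ominus x$ with $\ominus x\oplus x=0=x\oplus(\ominus x)$; (G3) for all $x,y\in G$ there is an automorphism $\mathrm{gyr}[x,y]$ of $(G,\oplus)$ with $x\oplus(y\oplus z)=(x\oplus y)\oplus\mathrm{gyr}[x,y](z)$ for all $z\in G$; (G4) $\mathrm{gyr}[x\oplus y,y]=\mathrm{gyr}[x,y]$ for all $x,y\in G$. A topological gyrogroup is a gyrogroup with a topology making $\oplus:G\times G\to G$ jointly continuous and $x\mapsto\ominus x$ continuous. It is a strongly topological gyrogroup if there is a neighborhood base $\mathscr U$ of $0$ with $\mathrm{gyr}[x,y](U)=U$ for all $U\in\mathscr U$ and $x,y\in G$. A subgyrogroup is a nonempty subset $H\subseteq G$ that is a gyrogroup under the inherited operation and such that $\mathrm{gyr}[a,b]$ restricts to an automorphism of $H$ for all $a,b\in H$. It is a strong subgyrogroup if $\mathrm{gyr}[x,y](H)=H$ for all $x,y\in G$. For such $H$ the left cosets $a\oplus H$ ($a\in G$) partition $G$; $G/H=\{a\oplus H:a\in G\}$ carries the quotient topology induced by $\pi:G\to G/H$, $\pi(a)=a\oplus H$. Subgyrogroups carry the subspace topology. A space $X$ is sequential if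 for each non-closed $A\subseteq X$ there are a point $x\in X\setminus A$ and a sequence in $A$ converging to $x$ in $X$. *)

theory Defs
  imports "HOL-Analysis.Analysis"
begin

definition gyro_zero :: "'a set \<Rightarrow> ('a \<Rightarrow> 'a \<Rightarrow> 'a) \<Rightarrow> 'a" where
  "gyro_zero G add = (THE e. e \<in> G \<and> (\<forall>a\<in>G. add e a = a \<and> add a e = a))"

definition gyro_neg :: "'a set \<Rightarrow> ('a \<Rightarrow> 'a \<Rightarrow> 'a) \<Rightarrow> 'a \<Rightarrow> 'a" where
  "gyro_neg G add x =
    (THE y. y \<in> G \<and> add y x = gyro_zero G add \<and> add x y = gyro_zero G add)"

definition automorphism_on :: "'a set \<Rightarrow> ('a \<Rightarrow> 'a \<Rightarrow> 'a) \<Rightarrow> ('a \<Rightarrow> 'a) \<Rightarrow> bool" where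
  "automorphism_on G add f \<longleftrightarrow>
    bij_betw f G G \<and> (\<forall>x\<in>G. \<forall>y\<in>G. f (add x y) = add (f x) (f y))"

text \<open>The gyrations are a parameter; on the carrier they are determined by the operation, since
  left translations are injective. Nothing is required of \<open>add\<close> and \<open>gyr\<close> outside the carrier, so
  the equality of maps in \<open>left_loop\<close> is pointwise on \<open>G\<close>.\<close>

locale gyrogroup =
  fixes G :: "'a set" and add :: "'a \<Rightarrow> 'a \<Rightarrow> 'a" and gyr :: "'a \<Rightarrow> 'a \<Rightarrow> 'a \<Rightarrow> 'a"
  assumes nonempty: "G \<noteq> {}"
    and add_closed: "\<And>x y. x \<in> G \<Longrightarrow> y \<in> G \<Longrightarrow> add x y \<in> G"
    and zero_unique: "\<exists>!e. e \<in> G \<and> (\<forall>a\<in>G. add e a = a \<and> add a e = a)"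
    and neg_unique: "\<And>x. x \<in> G \<Longrightarrow>
      \<exists>!y. y \<in> G \<and> add y x = gyro_zero G add \<and> add x y = gyro_zero G add"
    and gyr_automorphism: "\<And>x y. x \<in> G \<Longrightarrow> y \<in> G \<Longrightarrow> automorphism_on G add (gyr x y)"
    and gyr_assoc: "\<And>x y z. x \<in> G \<Longrightarrow> y \<in> G \<Longrightarrow> z \<in> G \<Longrightarrow>
      add x (add y z) = add (add x y) (gyr x y z)"
    and left_loop: "\<And>x y z. x \<in> G \<Longrightarrow> y \<in> G \<Longrightarrow> z \<in> G \<Longrightarrow>
      gyr (add x y) y z = gyr x y z"

text \<open>The carrier is the underlying set of the topology.\<close>

locale topological_gyrogroup =
  fixes X :: "'a topology" and add :: "'a \<Rightarrow> 'a \<Rightarrow> 'a" and gyr :: "'a \<Rightarrow> 'a \<Rightarrow> 'a \<Rightarrow> 'a"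
  assumes is_gyrogroup: "gyrogroup (topspace X) add gyr"
    and Hausdorff: "Hausdorff_space X"
    and add_continuous: "continuous_map (prod_topology X X) X (\<lambda>(x, y). add x y)"
    and neg_continuous: "continuous_map X X (gyro_neg (topspace X) add)"

text \<open>Members of a neighbourhood base are neighbourhoods, not necessarily open.
  The library notion \<^const>\<open>neighbourhood_base_at\<close> takes a predicate and does not by itself
  require every set satisfying it to be a neighbourhood, hence the first conjunct.\<close>

definition is_neighbourhood_base :: "'a topology \<Rightarrow> 'a \<Rightarrow> 'a set set \<Rightarrow> bool" where
  "is_neighbourhood_base X x \<U> \<longleftrightarrow>
    (\<forall>U\<in>\<U>. U \<subseteq> topspace X \<and> (\<exists>W. openin X W \<and> x \<in> W \<and> W \<subseteq> U)) \<and>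
    neighbourhood_base_at x (\<lambda>U. U \<in> \<U>) X"

locale strongly_topological_gyrogroup = topological_gyrogroup +
  assumes gyr_invariant_base:
    "\<exists>\<U>. is_neighbourhood_base X (gyro_zero (topspace X) add) \<U> \<and>
      (\<forall>U\<in>\<U>. \<forall>x\<in>topspace X. \<forall>y\<in>topspace X. gyr x y ` U = U)"

definition subgyrogroup ::
  "'a set \<Rightarrow> 'a set \<Rightarrow> ('a \<Rightarrow> 'a \<Rightarrow> 'a) \<Rightarrow> ('a \<Rightarrow> 'a \<Rightarrow> 'a \<Rightarrow> 'a) \<Rightarrow> bool" where
  "subgyrogroup H G add gyr \<longleftrightarrow>
    H \<noteq> {} \<and> H \<subseteq> G \<and> (\<exists>gyrH. gyrogroup H add gyrH) \<and>
    (\<forall>a\<in>H. \<forall>b\<in>H. automorphism_on H add (gyr a b))"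

definition strong_subgyrogroup ::
  "'a set \<Rightarrow> 'a set \<Rightarrow> ('a \<Rightarrow> 'a \<Rightarrow> 'a) \<Rightarrow> ('a \<Rightarrow> 'a \<Rightarrow> 'a \<Rightarrow> 'a) \<Rightarrow> bool" where
  "strong_subgyrogroup H G add gyr \<longleftrightarrow>
    subgyrogroup H G add gyr \<and> (\<forall>x\<in>G. \<forall>y\<in>G. gyr x y ` H = H)"

definition left_coset :: "('a \<Rightarrow> 'a \<Rightarrow> 'a) \<Rightarrow> 'a set \<Rightarrow> 'a \<Rightarrow> 'a set" where
  "left_coset add H a = add a ` H"

definition quotient_topology :: "'a topology \<Rightarrow> ('a \<Rightarrow> 'b) \<Rightarrow> 'b topology" where
  "quotient_topology X f =
    topology (\<lambda>U. U \<subseteq> f ` topspace X \<and> openin X {x \<in> topspace X. f x \<in> U})"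

lemma openin_quotient_topology:
  "openin (quotient_topology X f) U \<longleftrightarrow>
    U \<subseteq> f ` topspace X \<and> openin X {x \<in> topspace X. f x \<in> U}"
proof -
  have "istopology (\<lambda>U. U \<subseteq> f ` topspace X \<and> openin X {x \<in> topspace X. f x \<in> U})"
    unfolding istopology_def
  proof (intro conjI allI impI)
    fix S T
    assume S: "S \<subseteq> f ` topspace X \<and> openin X {x \<in> topspace X. f x \<in> S}"
      and T: "T \<subseteq> f ` topspace X \<and> openin X {x \<in> topspace X. f x \<in> T}"
    have "{x \<in> topspace X. f x \<in> S \<inter> T} =
        {x \<in> topspace X. f x \<in> S} \<inter> {x \<in> topspace X. f x \<in> T}"
      by auto
    then show "openin X {x \<in> topspace X. f x \<in> S \<inter> T}"
      using S T by auto
    show "S \<inter> T \<subseteq> f ` topspace X"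
      using S by blast
  next
    fix \<K>
    assume K: "\<forall>K\<in>\<K>. K \<subseteq> f ` topspace X \<and> openin X {x \<in> topspace X. f x \<in> K}"
    have "{x \<in> topspace X. f x \<in> \<Union>\<K>} = (\<Union>K\<in>\<K>. {x \<in> topspace X. f x \<in> K})"
      by auto
    then show "openin X {x \<in> topspace X. f x \<in> \<Union>\<K>}"
      using K by auto
    show "\<Union>\<K> \<subseteq> f ` topspace X"
      using K by blast
  qed
  then show ?thesis
    by (simp add: quotient_topology_def topology_inverse')
qed

lemma topspace_quotient_topology [simp]:
  "topspace (quotient_topology X f) = f ` topspace X"
proof (rule antisym)
  show "topspace (quotient_topology X f) \<subseteq> f ` topspace X"
    using openin_quotient_topology[of X f "topspace (quotient_topology X f)"] by simp
  have "{x \<in> topspace X. f x \<in> f ` topspace X} = topspace X"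
    by auto
  then have "openin (quotient_topology X f) (f ` topspace X)"
    by (simp add: openin_quotient_topology)
  then show "f ` topspace X \<subseteq> topspace (quotient_topology X f)"
    by (rule openin_subset)
qed

lemma quotient_map_quotient_topology: "quotient_map X (quotient_topology X f) f"
  unfolding quotient_map_def by (auto simp: openin_quotient_topology)

definition coset_space :: "'a topology \<Rightarrow> ('a \<Rightarrow> 'a \<Rightarrow> 'a) \<Rightarrow> 'a set \<Rightarrow> 'a set topology" where
  "coset_space X add H = quotient_topology X (left_coset add H)"

definition sequential_space :: "'a topology \<Rightarrow> bool" where
  "sequential_space X \<longleftrightarrow>
    (\<forall>A. A \<subseteq> topspace X \<and> \<not> closedin X A \<longrightarrow>
      (\<exists>x \<in> topspace X - A. \<exists>s :: nat \<Rightarrow> 'a. range s \<subseteq> A \<and> limitin X s x sequentially))"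

end

theory Submission imports Defs begin

text \<open>As in the theorem of Arhangel'skii and Uspenskij for topological groups, local compactness of
  \<open>H\<close> yields a closed neighbourhood \<open>P\<close> of zero on which the projection onto the coset space is
  a proper map. Its fibres are metrizable, being contained in translates of \<open>H\<close>.

  A proper preimage of a sequential space with metrizable fibres is sequential if it is regular:
  if the images of a sequence converge, the sequence has a cluster point in the limit fibre, this
  point is the intersection of countably many closed neighbourhoods and the fibre, and hence it is
  the limit of a subsequence. Consequently the image of a sequentially closed set is closed, also
  after cutting the set down to a closed neighbourhood of a given point. Hence \<open>P\<close> is sequential,
  and left translations carry this over to the whole gyrogroup.\<close>

subsection \<open>Proper preimages of sequential spaces\<close>

lemma sequential_spaceI:
  assumes "\<And>A. A \<subseteq> topspace X \<Longrightarrow>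
    (\<And>s x. range s \<subseteq> A \<Longrightarrow> limitin X (s :: nat \<Rightarrow> 'a) x sequentially \<Longrightarrow> x \<in> A) \<Longrightarrow> closedin X A"
  shows "sequential_space X"
  using assms unfolding sequential_space_def by (meson DiffI limitin_topspace)

lemma sequential_spaceD:
  assumes "sequential_space X" "A \<subseteq> topspace X"
    and "\<And>s x. range s \<subseteq> A \<Longrightarrow> limitin X (s :: nat \<Rightarrow> 'a) x sequentially \<Longrightarrow> x \<in> A"
  shows "closedin X A"
  using assms unfolding sequential_space_def by blast

lemma closure_of_meets:
  assumes "x \<in> X closure_of S" "openin X T" "x \<in> T"
  shows "\<exists>y. y \<in> S \<and> y \<in> T"
  using assms unfolding in_closure_of by blast

lemma closedin_limitin_frequently:
  assumes "closedin X C" "limitin X s x sequentially" "\<exists>\<^sub>F n in sequentially. s n \<in> C"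
  shows "x \<in> C"
proof (rule ccontr)
  assume "x \<notin> C"
  then have "\<forall>\<^sub>F n in sequentially. s n \<in> topspace X - C"
    using assms(1,2) by (metis Diff_iff closedin_def limitin_def)
  then show False
    using assms(3) by (simp add: frequently_def eventually_mono)
qed

text \<open>Otherwise, by compactness, finitely many open sets cover the part of the fibre in
  \<open>C\<close>, while \<open>s\<close> eventually avoids them inside \<open>C\<close>. What
  remains of \<open>C\<close> has a closed image that contains \<open>f (s n)\<close> infinitely
  often, hence also \<open>y\<close>, which contradicts the cover.\<close>

lemma proper_map_cluster_point:
  assumes f: "proper_map X Y f" and C: "closedin X C"
    and s: "range s \<subseteq> topspace X" "\<exists>\<^sub>F n in sequentially. s n \<in> C"
    and lim: "limitin Y (f \<circ> s) y sequentially"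
  obtains c where "c \<in> C" "f c = y"
    "\<And>U. openin X U \<Longrightarrow> c \<in> U \<Longrightarrow> \<exists>\<^sub>F n in sequentially. s n \<in> U \<inter> C"
proof -
  define F where "F = {x \<in> topspace X. f x = y} \<inter> C"
  have "\<exists>c\<in>F. \<forall>U. openin X U \<and> c \<in> U \<longrightarrow> (\<exists>\<^sub>F n in sequentially. s n \<in> U \<inter> C)"
  proof (rule ccontr)
    assume "\<not> ?thesis"
    then have *: "\<forall>c\<in>F. \<exists>U. openin X U \<and> c \<in> U \<and> (\<forall>\<^sub>F n in sequentially. s n \<notin> U \<inter> C)"
      by (simp add: frequently_def)
    define \<U> where "\<U> = {U. openin X U \<and> (\<forall>\<^sub>F n in sequentially. s n \<notin> U \<inter> C)}"
    have "y \<in> topspace Y"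
      using lim by (rule limitin_topspace)
    then have "compactin X F"
      unfolding F_def using f C by (simp add: proper_map_def closed_Int_compactin Int_commute compact_Int_closedin)
    moreover have "F \<subseteq> \<Union>\<U>" "\<And>U. U \<in> \<U> \<Longrightarrow> openin X U"
      using * by (auto simp: \<U>_def)
    ultimately obtain \<F> where \<F>: "finite \<F>" "\<F> \<subseteq> \<U>" "F \<subseteq> \<Union>\<F>"
      unfolding compactin_def by meson
    have "\<forall>\<^sub>F n in sequentially. \<forall>U\<in>\<F>. s n \<notin> U \<inter> C"
      using \<F> by (intro eventually_ball_finite) (auto simp: \<U>_def)
    with s(2) have fr: "\<exists>\<^sub>F n in sequentially. s n \<in> C \<and> (\<forall>U\<in>\<F>. s n \<notin> U \<inter> C)"
      by (simp add: eventually_frequently_simps(1) frequently_rev_mp frequently_eventually_frequently)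
    have "openin X (\<Union>\<F>)"
      using \<F> by (auto simp: \<U>_def)
    then have "closedin X (C - \<Union>\<F>)"
      using C by auto
    then have "closedin Y (f ` (C - \<Union>\<F>))"
      using f by (auto simp: proper_map_def closed_map_def)
    moreover have "\<exists>\<^sub>F n in sequentially. (f \<circ> s) n \<in> f ` (C - \<Union>\<F>)"
      using fr by (rule frequently_elim1) auto
    ultimately have "y \<in> f ` (C - \<Union>\<F>)"
      using lim closedin_limitin_frequently by metis
    then show False
      using \<F>(3) closedin_subset[OF C] by (auto simp: F_def)
  qed
  then show ?thesis
    using that by (auto simp: F_def)
qed

text \<open>Closed neighbourhoods \<open>K n\<close> of \<open>c\<close> are chosen whose traces on
  the fibre lie in shrinking balls. A subsequence that eventually stays in each \<open>K n\<close>
  must converge to \<open>c\<close>: otherwise it clusters at a point \<open>c'\<close> of the fibre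
  outside a neighbourhood of \<open>c\<close>, but \<open>c'\<close> lies in every
  \<open>K n\<close> and so has distance zero from \<open>c\<close>.\<close>

lemma limitin_subseq_of_cluster_point:
  assumes f: "proper_map X Y f" and X: "regular_space X"
    and M: "metrizable_space (subtopology X {x \<in> topspace X. f x = y})"
    and s: "range s \<subseteq> topspace X" and lim: "limitin Y (f \<circ> s) y sequentially"
    and c: "c \<in> topspace X" "f c = y" "\<And>U. openin X U \<Longrightarrow> c \<in> U \<Longrightarrow> \<exists>\<^sub>F n in sequentially. s n \<in> U"
  obtains r where "strict_mono r" "limitin X (s \<circ> r) c sequentially"
proof -
  define F where "F = {x \<in> topspace X. f x = y}"
  obtain M d where Md: "Metric_space M d" and top: "subtopology X F = Metric_space.mtopology M d"
    using M unfolding metrizable_space_def F_def by blast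
  interpret Metric_space M d by (rule Md)
  have "topspace (subtopology X F) = M"
    by (simp add: top)
  then have MF: "M = F"
    by (auto simp: F_def)
  have "c \<in> F"
    using c by (simp add: F_def)
  have "\<exists>V K. openin X V \<and> closedin X K \<and> c \<in> V \<and> V \<subseteq> K \<and> K \<inter> F \<subseteq> mball c (inverse (real (Suc n)))" for n
  proof -
    have "openin (subtopology X F) (mball c (inverse (real (Suc n))))"
      by (simp add: top)
    then obtain W where W: "openin X W" "mball c (inverse (real (Suc n))) = W \<inter> F"
      by (auto simp: openin_subtopology)
    have "c \<in> mball c (inverse (real (Suc n)))"
      using \<open>c \<in> F\<close> unfolding MF[symmetric] by simp
    then have "c \<in> W"
      using W by blast
    then obtain V K where "openin X V" "closedin X K" "c \<in> V" "V \<subseteq> K" "K \<subseteq> W"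
      using X W(1) unfolding neighbourhood_base_of_closedin[symmetric] neighbourhood_base_of by metis
    then show ?thesis
      unfolding W(2) by blast
  qed
  then obtain V K where V: "\<And>n. openin X (V n)" "\<And>n. closedin X (K n)" "\<And>n. c \<in> V n" "\<And>n. V n \<subseteq> K n"
      and KF: "\<And>n. K n \<inter> F \<subseteq> mball c (inverse (real (Suc n)))"
    by metis
  \<comment> \<open>The \<open>V n\<close> may fail to decrease. With their finite intersections,
    all terms of the subsequence from index \<open>n\<close> on lie in \<open>K n\<close>.\<close>
  define U where "U n = (\<Inter>i\<le>n. V i)" for n
  have U: "openin X (U n)" "c \<in> U n" for n
    using V by (auto simp: U_def intro!: openin_INT2 openin_Inter)
  have "\<exists>r. \<forall>n. s (r n) \<in> U n \<and> r n < r (Suc n)"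
  proof (rule dependent_nat_choice)
    show "\<exists>m. s m \<in> U 0"
      using c(3)[OF U] by (auto dest: frequently_ex)
    show "\<exists>m'. s m' \<in> U (Suc n) \<and> m < m'" for m n
      using c(3)[OF U, of "Suc n"] unfolding frequently_sequentially by (meson Suc_le_lessD)
  qed
  then obtain r where r: "\<And>n. s (r n) \<in> U n" "strict_mono r"
    by (auto simp: strict_mono_Suc_iff)
  have "limitin X (s \<circ> r) c sequentially"
    unfolding limitin_def
  proof (intro conjI allI impI)
    fix O' assume O': "openin X O' \<and> c \<in> O'"
    show "\<forall>\<^sub>F n in sequentially. (s \<circ> r) n \<in> O'"
    proof (rule ccontr)
      assume "\<not> ?thesis"
      then have "\<exists>\<^sub>F n in sequentially. (s \<circ> r) n \<notin> O'"
        by (simp add: frequently_def)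
      then have "\<exists>\<^sub>F n in sequentially. (s \<circ> r) n \<in> topspace X - O'"
        by (rule frequently_elim1) (use s in auto)
      moreover have "closedin X (topspace X - O')" "range (s \<circ> r) \<subseteq> topspace X"
        using O' s by auto
      moreover have "limitin Y (f \<circ> (s \<circ> r)) y sequentially"
        using limitin_subsequence[OF r(2) lim] by (simp add: o_assoc)
      ultimately obtain c' where c': "c' \<in> topspace X - O'" "f c' = y"
        and cl: "\<And>U. openin X U \<Longrightarrow> c' \<in> U \<Longrightarrow> \<exists>\<^sub>F n in sequentially. (s \<circ> r) n \<in> U \<inter> (topspace X - O')"
        using proper_map_cluster_point[OF f] by metis
      have "c' \<in> K n" for n
      proof (rule ccontr)
        assume "c' \<notin> K n"
        then have "openin X (topspace X - K n)" "c' \<in> topspace X - K n"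
          using c' V(2) by auto
        then have "\<exists>\<^sub>F m in sequentially. (s \<circ> r) m \<notin> K n"
          by (rule frequently_elim1[OF cl]) auto
        then obtain m where "m \<ge> n" "s (r m) \<notin> K n"
          by (auto simp: frequently_sequentially)
        moreover have "U m \<subseteq> K n"
          using \<open>m \<ge> n\<close> V(4) by (auto simp: U_def)
        ultimately show False
          using r(1) by blast
      qed
      moreover have "c' \<in> F"
        using c' by (simp add: F_def)
      ultimately have "c' \<in> mball c (inverse (real (Suc n)))" for n
        using KF by blast
      then have "d c c' < inverse (real (Suc n))" for n
        by (simp only: in_mball)
      then have "d c c' \<le> 0"
        by (meson not_le reals_Archimedean order.asym)
      moreover have "c \<in> M" "c' \<in> M"
        using \<open>c \<in> F\<close> \<open>c' \<in> F\<close> MF by simp_all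
      ultimately have "c' = c"
        by (metis nonneg zero order.antisym)
      then show False
        using c' O' by blast
    qed
  qed (use c in auto)
  then show ?thesis
    using that r(2) by blast
qed

lemma sequential_space_proper_map_preimage:
  assumes f: "proper_map X Y f" "continuous_map X Y f" and X: "regular_space X"
    and M: "\<And>y. y \<in> topspace Y \<Longrightarrow> metrizable_space (subtopology X {x \<in> topspace X. f x = y})"
    and Y: "sequential_space Y"
  shows "sequential_space X"
proof (rule sequential_spaceI)
  fix A assume A: "A \<subseteq> topspace X"
    and seq: "\<And>s x. range s \<subseteq> A \<Longrightarrow> limitin X (s :: nat \<Rightarrow> 'a) x sequentially \<Longrightarrow> x \<in> A"
  \<comment> \<open>A convergent sequence of images is lifted to \<open>A \<inter> C\<close>. The
    lift clusters at a point \<open>c\<close> of \<open>C\<close> over the limit, and a subsequence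
    converges to \<open>c\<close>, so \<open>c\<close> belongs to \<open>A\<close>.\<close>
  have image: "closedin Y (f ` (A \<inter> C))" if C: "closedin X C" for C
  proof (rule sequential_spaceD[OF Y])
    show "f ` (A \<inter> C) \<subseteq> topspace Y"
      using A f(2) by (auto simp: continuous_map_def)
    fix t y assume t: "range t \<subseteq> f ` (A \<inter> C)" and lim: "limitin Y (t :: nat \<Rightarrow> 'b) y sequentially"
    have "\<forall>n. \<exists>a. a \<in> A \<inter> C \<and> f a = t n"
      using t by (metis (no_types, lifting) image_iff rangeI subsetD)
    then obtain s where s: "\<And>n. s n \<in> A \<inter> C" "\<And>n. f (s n) = t n"
      by metis
    have lim': "limitin Y (f \<circ> s) y sequentially"
      using lim s(2) by (simp add: o_def)
    have rs: "range s \<subseteq> topspace X"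
      using s(1) A by blast
    have "\<exists>\<^sub>F n in sequentially. s n \<in> C"
      using s(1) by (simp add: frequently_const)
    then obtain c where c: "c \<in> C" "f c = y"
      and cl: "\<And>U. openin X U \<Longrightarrow> c \<in> U \<Longrightarrow> \<exists>\<^sub>F n in sequentially. s n \<in> U \<inter> C"
      using proper_map_cluster_point[OF f(1) C rs _ lim'] by metis
    have cX: "c \<in> topspace X"
      using c closedin_subset[OF C] by blast
    have "\<exists>\<^sub>F n in sequentially. s n \<in> U" if "openin X U" "c \<in> U" for U
      using cl[OF that] by (rule frequently_elim1) simp
    then obtain r where "strict_mono r" and r: "limitin X (s \<circ> r) c sequentially"
      using limitin_subseq_of_cluster_point[OF f(1) X M[OF limitin_topspace[OF lim]] rs lim' cX c(2)]
      by metis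
    moreover have "range (s \<circ> r) \<subseteq> A"
      using s(1) by auto
    ultimately have "c \<in> A"
      using seq by blast
    then show "y \<in> f ` (A \<inter> C)"
      using c by blast
  qed
  \<comment> \<open>If \<open>b\<close> is not in \<open>A\<close>, a closed neighbourhood
    \<open>K\<close> of \<open>b\<close> misses the trace of \<open>A\<close> on the fibre of
    \<open>b\<close>. But \<open>b\<close> is in the closure of \<open>A \<inter> K\<close>, so
    \<open>image\<close> yields a point of \<open>A \<inter> K\<close> in that fibre.\<close>
  have "b \<in> A" if b: "b \<in> X closure_of A" for b
  proof (rule ccontr)
    assume "b \<notin> A"
    have bX: "b \<in> topspace X"
      using b by (auto simp: in_closure_of)
    define F where "F = {x \<in> topspace X. f x = f b}"
    have fb: "f b \<in> topspace Y"
      using bX f(2) by (auto simp: continuous_map_def)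
    obtain M d where Md: "Metric_space M d" and top: "subtopology X F = Metric_space.mtopology M d"
      using M[OF fb] unfolding metrizable_space_def F_def by blast
    interpret Metric_space M d by (rule Md)
    have "topspace (subtopology X F) = M"
      by (simp add: top)
    then have MF: "M = F"
      by (auto simp: F_def)
    \<comment> \<open>In a metric space sequential closedness suffices, and convergence within the
      fibre is convergence in \<open>X\<close>.\<close>
    have "closedin mtopology (A \<inter> F)"
      unfolding metric_closedin_iff_sequentially_closed
    proof (intro conjI allI impI)
      fix s l assume s: "range s \<subseteq> A \<inter> F \<and> limitin mtopology s l sequentially"
      then have "l \<in> F" "limitin X s l sequentially"
        by (auto simp: top[symmetric] limitin_subtopology)
      then show "l \<in> A \<inter> F"
        using seq s by blast
    qed (auto simp: MF)
    then obtain D where D: "closedin X D" "A \<inter> F = D \<inter> F"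
      by (auto simp: top[symmetric] closedin_subtopology)
    then have "openin X (topspace X - D)" "b \<in> topspace X - D"
      using bX \<open>b \<notin> A\<close> by (auto simp: F_def)
    then obtain V K where "openin X V" "closedin X K" "b \<in> V" "V \<subseteq> K" "K \<subseteq> topspace X - D"
      using X unfolding neighbourhood_base_of_closedin[symmetric] neighbourhood_base_of by metis
    then have VK: "openin X V" "closedin X K" "b \<in> V" "V \<subseteq> K" "A \<inter> F \<inter> K = {}"
      using D(2) by auto
    have "b \<in> X closure_of (A \<inter> K)"
      unfolding in_closure_of
    proof (intro conjI allI impI bX)
      fix T assume "b \<in> T \<and> openin X T"
      then obtain a where "a \<in> A" "a \<in> T \<inter> V"
        using b VK unfolding in_closure_of by (metis IntI openin_Int)
      then show "\<exists>a. a \<in> A \<inter> K \<and> a \<in> T"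
        using VK by blast
    qed
    then have "f b \<in> Y closure_of f ` (A \<inter> K)"
      using f(2) by (meson continuous_map_image_closure_subset image_subset_iff)
    then have "f b \<in> f ` (A \<inter> K)"
      using image[OF VK(2)] by (simp add: closure_of_closedin)
    then show False
      using VK(5) A by (auto simp: F_def)
  qed
  then show "closedin X A"
    using A by (simp add: closure_of_subset_eq[symmetric] subsetI)
qed

subsection \<open>Gyrogroups\<close>

abbreviation (in gyrogroup) zero :: 'a where "zero \<equiv> gyro_zero G add"
abbreviation (in gyrogroup) neg :: "'a \<Rightarrow> 'a" where "neg \<equiv> gyro_neg G add"

context gyrogroup
begin

lemma zero_closed [simp]: "zero \<in> G"
  and zero_left [simp]: "a \<in> G \<Longrightarrow> add zero a = a"
  and zero_right [simp]: "a \<in> G \<Longrightarrow> add a zero = a"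
  using theI'[OF zero_unique] by (auto simp: gyro_zero_def)

lemma neg_closed [simp]: "a \<in> G \<Longrightarrow> neg a \<in> G"
  and neg_left [simp]: "a \<in> G \<Longrightarrow> add (neg a) a = zero"
  and neg_right [simp]: "a \<in> G \<Longrightarrow> add a (neg a) = zero"
  using theI'[OF neg_unique[of a]] by (auto simp: gyro_neg_def)

declare add_closed [simp]

lemma gyr_closed [simp]: "x \<in> G \<Longrightarrow> y \<in> G \<Longrightarrow> z \<in> G \<Longrightarrow> gyr x y z \<in> G"
  and gyr_add: "x \<in> G \<Longrightarrow> y \<in> G \<Longrightarrow> z \<in> G \<Longrightarrow> w \<in> G \<Longrightarrow>
    gyr x y (add z w) = add (gyr x y z) (gyr x y w)"
  and gyr_inj: "x \<in> G \<Longrightarrow> y \<in> G \<Longrightarrow> inj_on (gyr x y) G"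
  using gyr_automorphism[of x y] by (auto simp: automorphism_on_def bij_betw_def)

lemma neg_zero [simp]: "neg zero = zero"
  using neg_left[of zero] zero_right[of "neg zero"] by simp

text \<open>Adding \<open>neg a\<close> on the left turns \<open>add a z\<close> into
  \<open>gyr (neg a) a z\<close>. This gyration is not yet known to be the identity, but it is
  injective.\<close>

lemma add_left_inj:
  assumes "a \<in> G" "z \<in> G" "w \<in> G" "add a z = add a w"
  shows "z = w"
proof -
  have "gyr (neg a) a t = add (neg a) (add a t)" if "t \<in> G" for t
    using gyr_assoc[of "neg a" a t] assms(1) that by simp
  then have "gyr (neg a) a z = gyr (neg a) a w"
    using assms by simp
  then show ?thesis
    using gyr_inj[of "neg a" a] assms by (simp add: inj_on_eq_iff)
qed

text \<open>Since \<open>neg a\<close> and \<open>a\<close> add up to \<open>zero\<close>, the left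
  loop property equates \<open>gyr (neg a) a\<close> with \<open>gyr zero a\<close>, which is the
  identity by left injectivity.\<close>

lemma left_cancel [simp]:
  assumes "a \<in> G" "b \<in> G"
  shows "add (neg a) (add a b) = b"
proof -
  have eq: "add a b = add a (gyr zero a b)"
    using gyr_assoc[of zero a b] assms by (simp only: zero_left zero_closed add_closed)
  have "gyr zero a b = b"
    by (rule add_left_inj[OF assms(1) _ assms(2) eq[symmetric]]) (use assms in simp)
  then have "gyr (neg a) a b = b"
    using left_loop[of "neg a" a b] assms by simp
  then show ?thesis
    using gyr_assoc[of "neg a" a b] assms by simp
qed

lemma left_cancel_neg [simp]:
  assumes "a \<in> G" "b \<in> G"
  shows "add a (add (neg a) b) = b"
  by (rule add_left_inj[of "neg a"]) (use assms in auto)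

lemma gyr_zero_right [simp]:
  assumes "x \<in> G" "y \<in> G"
  shows "gyr x y zero = zero"
proof (rule add_left_inj[of "gyr x y zero"])
  show "add (gyr x y zero) (gyr x y zero) = add (gyr x y zero) zero"
    using assms gyr_add[of x y zero zero] by simp
qed (use assms in auto)

text \<open>The right difference of \<open>b\<close> and \<open>a\<close> is usually written as the sum of \<open>b\<close> and
  \<open>gyr b a (neg a)\<close>. The expression chosen here is visibly continuous.\<close>

definition right_diff :: "'a \<Rightarrow> 'a \<Rightarrow> 'a" where
  "right_diff b a = add b (add (neg (add b a)) b)"

text \<open>Solves the associative law for \<open>add b (add a (neg a))\<close> for its gyration
  term; this connects \<open>right_diff\<close> with the usual formula.\<close>

lemma gyr_neg_eq:
  assumes "a \<in> G" "b \<in> G"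
  shows "gyr b a (neg a) = add (neg (add b a)) b"
proof -
  have "add (add b a) (gyr b a (neg a)) = b"
    using gyr_assoc[of b a "neg a"] assms by simp
  then show ?thesis
    using left_cancel[of "add b a" "gyr b a (neg a)"] assms by simp
qed

lemma right_diff_closed [simp]: "a \<in> G \<Longrightarrow> b \<in> G \<Longrightarrow> right_diff b a \<in> G"
  by (simp add: right_diff_def)

text \<open>By the left loop property the gyration in the right difference is
  \<open>gyr x a\<close>, so the associative law collapses the expression to
  \<open>add x (add a (neg a))\<close>.\<close>

lemma right_diff_add [simp]:
  assumes "x \<in> G" "a \<in> G"
  shows "right_diff (add x a) a = x"
  using assms left_loop[of x a "neg a"] gyr_assoc[of x a "neg a"]
  by (simp add: right_diff_def gyr_neg_eq[symmetric])

text \<open>The right difference is \<open>add b w\<close>. Once \<open>gyr b w\<close> is known to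
  send \<open>g a\<close> to \<open>a\<close>, its sum with \<open>a\<close> reassociates to
  \<open>add b (add w (g a))\<close>, and \<open>add w (g a)\<close> is the image of
  \<open>zero\<close> under \<open>g\<close>.\<close>

lemma add_right_diff [simp]:
  assumes b: "b \<in> G" and a: "a \<in> G"
  shows "add (right_diff b a) a = b"
proof -
  define g where "g = gyr b a"
  define w where "w = g (neg a)"
  have [simp]: "w \<in> G" "\<And>x. x \<in> G \<Longrightarrow> g x \<in> G"
    using a b by (auto simp: w_def g_def)
  have ba: "add (add b a) w = b"
    using gyr_assoc[of b a "neg a"] a b by (simp add: w_def g_def)
  \<comment> \<open>\<open>gyr b w\<close> turns out to be the inverse of \<open>gyr b a\<close>.\<close>
  have eq: "add b a = add b (gyr (add b a) w (g a))"
  proof -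
    have "add b a = add b (add a (add (neg a) a))"
      using a b by simp
    also have "\<dots> = add (add b a) (g (add (neg a) a))"
      using gyr_assoc[of b a "add (neg a) a"] a b by (simp add: g_def)
    also have "g (add (neg a) a) = add w (g a)"
      unfolding g_def w_def using a b by (intro gyr_add) auto
    also have "add (add b a) (add w (g a)) = add (add (add b a) w) (gyr (add b a) w (g a))"
      using a b by (intro gyr_assoc) auto
    also note ba
    finally show ?thesis .
  qed
  have "gyr (add b a) w (g a) = a"
    by (rule add_left_inj[OF b _ a eq[symmetric]]) (use a b in simp)
  \<comment> \<open>The left loop property lets \<open>add (add b a) w\<close>, which is
    \<open>b\<close>, replace \<open>add b a\<close> as first argument.\<close>
  then have ga: "gyr b w (g a) = a"
    using left_loop[of "add b a" w "g a"] a b ba by simp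
  have "add w (g a) = zero"
    using gyr_add[of b a "neg a" a] a b by (simp add: w_def g_def)
  then have "b = add b (add w (g a))"
    using b by simp
  also have "\<dots> = add (add b w) a"
    using gyr_assoc[of b w "g a"] a b ga by simp
  finally show ?thesis
    using a b by (simp add: right_diff_def w_def g_def gyr_neg_eq)
qed

end

section \<open>Strong subgyrogroups and their left cosets\<close>

locale strong_subgyrogroup_of = gyrogroup +
  fixes H :: "'a set"
  assumes strong: "strong_subgyrogroup H G add gyr"
begin

lemma sub_subset: "H \<subseteq> G"
  and sub_gyr: "x \<in> G \<Longrightarrow> y \<in> G \<Longrightarrow> gyr x y ` H = H"
  using strong by (auto simp: strong_subgyrogroup_def subgyrogroup_def)

lemma sub_in [simp]: "h \<in> H \<Longrightarrow> h \<in> G"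
  using sub_subset by blast

text \<open>The definition gives \<open>H\<close> a zero and inverses of its own; left cancellation
  in \<open>G\<close> identifies them with those of \<open>G\<close>.\<close>

lemma sub_zero [simp]: "zero \<in> H"
  and sub_add [simp]: "h \<in> H \<Longrightarrow> k \<in> H \<Longrightarrow> add h k \<in> H"
  and sub_neg [simp]: "h \<in> H \<Longrightarrow> neg h \<in> H"
proof -
  obtain gyrH where "gyrogroup H add gyrH"
    using strong by (auto simp: strong_subgyrogroup_def subgyrogroup_def)
  then interpret H: gyrogroup H add gyrH .
  have "H.zero = zero"
    by (rule add_left_inj[of H.zero]) (use H.zero_left H.zero_closed in auto)
  then show "zero \<in> H"
    using H.zero_closed by simp
  show "add h k \<in> H" if "h \<in> H" "k \<in> H" for h k
    using that by (rule H.add_closed)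
  show "neg h \<in> H" if "h \<in> H" for h
  proof -
    have "H.neg h = neg h"
      by (rule add_left_inj[of h]) (use that H.neg_closed[of h] H.neg_right[of h] \<open>H.zero = zero\<close> in auto)
    then show ?thesis
      using H.neg_closed[OF that] by simp
  qed
qed

lemma coset_self: "a \<in> G \<Longrightarrow> a \<in> left_coset add H a"
  unfolding left_coset_def by (rule rev_image_eqI[OF sub_zero]) simp

text \<open>Left addition of \<open>h\<close> permutes \<open>H\<close>, and reassociating
  introduces \<open>gyr x h\<close>. Here \<open>x\<close> is any element of \<open>G\<close>, so
  the invariance of \<open>H\<close> under all gyrations of \<open>G\<close> is used.\<close>

lemma coset_add [simp]:
  assumes x: "x \<in> G" and h: "h \<in> H"
  shows "left_coset add H (add x h) = left_coset add H x"
proof -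
  have "add h ` H = H"
  proof
    show "H \<subseteq> add h ` H"
    proof
      fix k assume "k \<in> H"
      then have "k = add h (add (neg h) k)" "add (neg h) k \<in> H"
        using h by auto
      then show "k \<in> add h ` H"
        by blast
    qed
  qed (use h in auto)
  then have "left_coset add H x = add x ` add h ` H"
    by (simp add: left_coset_def)
  also have "\<dots> = (\<lambda>k. add x (add h k)) ` H"
    by (rule image_image)
  also have "\<dots> = (\<lambda>k. add (add x h) (gyr x h k)) ` H"
    using x h gyr_assoc by (intro image_cong) auto
  also have "\<dots> = add (add x h) ` gyr x h ` H"
    by (rule image_image[symmetric])
  also have "gyr x h ` H = H"
    using x h by (intro sub_gyr) auto
  finally show ?thesis
    by (simp add: left_coset_def)
qed

lemma coset_eqE:
  assumes "x \<in> G" "y \<in> G" "left_coset add H x = left_coset add H y"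
  obtains h where "h \<in> H" "x = add y h"
  using coset_self[of x] assms by (auto simp: left_coset_def)

end

subsection \<open>Topological gyrogroups\<close>

context topological_gyrogroup
begin

sublocale gyrogroup "topspace X" add gyr
  by (rule is_gyrogroup)

lemma continuous_add:
  assumes "continuous_map Z X f" "continuous_map Z X g"
  shows "continuous_map Z X (\<lambda>z. add (f z) (g z))"
  using continuous_map_compose[OF continuous_map_pairedI[OF assms] add_continuous] by (simp add: o_def)

lemma continuous_neg:
  assumes "continuous_map Z X f"
  shows "continuous_map Z X (\<lambda>z. neg (f z))"
  using continuous_map_compose[OF assms neg_continuous] by (simp add: o_def)

lemma continuous_right_diff:
  assumes "continuous_map Z X f" "continuous_map Z X g"
  shows "continuous_map Z X (\<lambda>z. right_diff (f z) (g z))"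
  unfolding right_diff_def using assms by (intro continuous_add continuous_neg)

lemma continuous_left_translation:
  "a \<in> topspace X \<Longrightarrow> continuous_map X X (add a)"
  using continuous_add[of X "\<lambda>_. a" "\<lambda>x. x"] by simp

lemma homeomorphic_left_translation:
  assumes "a \<in> topspace X"
  shows "homeomorphic_maps X X (add a) (add (neg a))"
  using assms continuous_left_translation by (simp add: homeomorphic_maps_def)

text \<open>The translate is the preimage of \<open>V\<close> under the continuous map that takes
  right differences with \<open>x\<close>. For \<open>V\<close> around \<open>zero\<close> it is a
  neighbourhood of \<open>x\<close>.\<close>

lemma openin_right_translation:
  assumes V: "openin X V" and x: "x \<in> topspace X"
  shows "openin X ((\<lambda>v. add v x) ` V)"
proof -
  have "(\<lambda>v. add v x) ` V = {s \<in> topspace X. right_diff s x \<in> V}"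
  proof (intro set_eqI iffI)
    fix s assume "s \<in> (\<lambda>v. add v x) ` V"
    then show "s \<in> {s \<in> topspace X. right_diff s x \<in> V}"
      using x openin_subset[OF V] by auto
  next
    fix s assume s: "s \<in> {s \<in> topspace X. right_diff s x \<in> V}"
    then have "s = add (right_diff s x) x"
      using x by simp
    then show "s \<in> (\<lambda>v. add v x) ` V"
      using s by blast
  qed
  moreover have "continuous_map X X (\<lambda>s. right_diff s x)"
    using x by (intro continuous_right_diff) auto
  ultimately show ?thesis
    using V by (simp add: openin_continuous_map_preimage)
qed

lemma nbhd_zero_binary:
  assumes "continuous_map (prod_topology X X) X (\<lambda>(x, y). m x y)" "m zero zero = zero"
    and "openin X W" "zero \<in> W"
  obtains V where "openin X V" "zero \<in> V" "\<And>x y. x \<in> V \<Longrightarrow> y \<in> V \<Longrightarrow> m x y \<in> W"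
proof -
  define P where "P = {p \<in> topspace (prod_topology X X). (\<lambda>(x, y). m x y) p \<in> W}"
  have "openin (prod_topology X X) P"
    unfolding P_def using assms by (intro openin_continuous_map_preimage)
  moreover have "(zero, zero) \<in> P"
    using assms by (simp add: P_def)
  ultimately have "\<exists>U V. openin X U \<and> openin X V \<and> zero \<in> U \<and> zero \<in> V \<and> U \<times> V \<subseteq> P"
    by (simp only: openin_prod_topology_alt)
  then obtain U V where UV: "openin X U" "openin X V" "zero \<in> U" "zero \<in> V" "U \<times> V \<subseteq> P"
    by blast
  show ?thesis
  proof
    show "openin X (U \<inter> V)" "zero \<in> U \<inter> V"
      using UV by auto
    show "m x y \<in> W" if "x \<in> U \<inter> V" "y \<in> U \<inter> V" for x y
      using that UV(5) by (auto simp: P_def)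
  qed
qed

lemma nbhd_zero_left_diff:
  assumes "openin X W" "zero \<in> W"
  obtains V where "openin X V" "zero \<in> V" "\<And>x y. x \<in> V \<Longrightarrow> y \<in> V \<Longrightarrow> add (neg x) y \<in> W"
proof -
  have "continuous_map (prod_topology X X) X (\<lambda>(x, y). add (neg x) y)"
    unfolding case_prod_unfold
    by (intro continuous_add continuous_neg continuous_map_fst continuous_map_snd)
  from this _ assms show ?thesis
    by (rule nbhd_zero_binary) (use that in auto)
qed

text \<open>It suffices to work at \<open>zero\<close>. If left differences of points of
  \<open>V\<close> lie in \<open>W'\<close>, then so does the closure of \<open>V\<close>: for
  \<open>z\<close> in the closure, the neighbourhood \<open>V + z\<close> of \<open>z\<close> meets
  \<open>V\<close> in some \<open>add v z\<close>, and \<open>z\<close> is the left difference of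
  \<open>v\<close> and \<open>add v z\<close>.\<close>

lemma regular: "regular_space X"
  unfolding neighbourhood_base_of_closedin[symmetric] neighbourhood_base_of
proof (intro allI impI)
  fix W x assume W: "openin X W \<and> x \<in> W"
  then have x: "x \<in> topspace X"
    using openin_subset by blast
  define W' where "W' = {z \<in> topspace X. add x z \<in> W}"
  have "openin X W'"
    unfolding W'_def using W continuous_left_translation[OF x] by (intro openin_continuous_map_preimage) auto
  moreover have "zero \<in> W'"
    using W x by (simp add: W'_def)
  ultimately obtain V where V: "openin X V" "zero \<in> V"
      and VW: "\<And>a b. a \<in> V \<Longrightarrow> b \<in> V \<Longrightarrow> add (neg a) b \<in> W'"
    by (rule nbhd_zero_left_diff) (rule that)
  have Vsub: "V \<subseteq> topspace X"
    by (rule openin_subset[OF V(1)])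
  have cl: "X closure_of V \<subseteq> W'"
  proof
    fix z assume z: "z \<in> X closure_of V"
    then have zX: "z \<in> topspace X"
      by (simp add: in_closure_of)
    have "z \<in> (\<lambda>v. add v z) ` V"
      by (rule rev_image_eqI[OF V(2)]) (simp add: zX)
    then have "\<exists>y. y \<in> V \<and> y \<in> (\<lambda>v. add v z) ` V"
      by (rule closure_of_meets[OF z openin_right_translation[OF V(1) zX]])
    then obtain v where v: "v \<in> V" "add v z \<in> V"
      by auto
    then have "add (neg v) (add v z) \<in> W'"
      by (rule VW)
    then show "z \<in> W'"
      using v(1) Vsub zX by (simp add: subsetD)
  qed
  have nx: "neg x \<in> topspace X"
    using x by simp
  show "\<exists>U C. openin X U \<and> closedin X C \<and> x \<in> U \<and> U \<subseteq> C \<and> C \<subseteq> W"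
  proof (intro exI conjI)
    show "openin X {z \<in> topspace X. add (neg x) z \<in> V}"
      using continuous_left_translation[OF nx] V(1) by (rule openin_continuous_map_preimage)
    show "closedin X {z \<in> topspace X. add (neg x) z \<in> X closure_of V}"
      using continuous_left_translation[OF nx] by (rule closedin_continuous_map_preimage) simp
    show "x \<in> {z \<in> topspace X. add (neg x) z \<in> V}"
      using x V by simp
    show "{z \<in> topspace X. add (neg x) z \<in> V} \<subseteq> {z \<in> topspace X. add (neg x) z \<in> X closure_of V}"
      using closure_of_subset[OF Vsub] by blast
    show "{z \<in> topspace X. add (neg x) z \<in> X closure_of V} \<subseteq> W"
    proof clarify
      fix z assume z: "z \<in> topspace X" "add (neg x) z \<in> X closure_of V"
      then have "add (neg x) z \<in> W'"
        using cl by blast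
      then have "add x (add (neg x) z) \<in> W"
        unfolding W'_def by blast
      then show "z \<in> W"
        using x z by simp
    qed
  qed
qed

text \<open>The sum is the projection, along the compact factor \<open>K\<close>, of the closed set
  of pairs whose right difference lies in \<open>C\<close>.\<close>

lemma closedin_add_compact:
  assumes C: "closedin X C" and K: "compactin X K"
  shows "closedin X {add c k |c k. c \<in> C \<and> k \<in> K}"
proof -
  define Z where "Z = prod_topology X (subtopology X K)"
  define T where "T = {p \<in> topspace Z. right_diff (fst p) (snd p) \<in> C}"
  have Ksub: "K \<subseteq> topspace X" and Csub: "C \<subseteq> topspace X"
    using C K by (auto simp: compactin_def closedin_subset)
  have snd: "continuous_map Z X snd"
    using continuous_map_snd[of X "subtopology X K"] unfolding Z_def
    by (simp add: continuous_map_in_subtopology)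
  have "continuous_map Z X (\<lambda>p. right_diff (fst p) (snd p))"
    using snd continuous_map_fst[of X "subtopology X K"] unfolding Z_def by (intro continuous_right_diff)
  then have "closedin Z T"
    unfolding T_def using C by (rule closedin_continuous_map_preimage)
  moreover have "compact_space (subtopology X K)"
    using K by (rule compact_space_subtopology)
  ultimately have "closedin X (fst ` T)"
    using Abstract_Topological_Spaces.closed_map_fst unfolding Z_def closed_map_def by blast
  moreover have "fst ` T = {add c k |c k. c \<in> C \<and> k \<in> K}"
  proof (intro set_eqI iffI)
    fix y assume "y \<in> fst ` T"
    then obtain k where "y \<in> topspace X" "k \<in> K" "right_diff y k \<in> C"
      by (auto simp: T_def Z_def)
    moreover from this have "y = add (right_diff y k) k"
      using Ksub by (simp add: subsetD)
    ultimately show "y \<in> {add c k |c k. c \<in> C \<and> k \<in> K}"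
      by blast
  next
    fix y assume "y \<in> {add c k |c k. c \<in> C \<and> k \<in> K}"
    then obtain c k where "c \<in> C" "k \<in> K" "y = add c k"
      by blast
    then have "(y, k) \<in> T"
      using Ksub Csub by (auto simp: T_def Z_def subsetD)
    then show "y \<in> fst ` T"
      by (rule rev_image_eqI) simp
  qed
  ultimately show ?thesis
    by simp
qed

end

section \<open>The projection onto the coset space\<close>

locale topological_gyrogroup_coset = topological_gyrogroup X add gyr +
  strong_subgyrogroup_of "topspace X" add gyr H
  for X :: "'a topology" and add gyr H
begin

abbreviation proj :: "'a \<Rightarrow> 'a set" where "proj \<equiv> left_coset add H"

lemma quotient_map_proj: "quotient_map X (coset_space X add H) proj"
  unfolding coset_space_def by (rule quotient_map_quotient_topology)

lemma closure_of_saturated: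
  assumes S: "\<And>s h. s \<in> S \<Longrightarrow> h \<in> H \<Longrightarrow> add s h \<in> S"
    and x: "x \<in> X closure_of S" and h: "h \<in> H"
  shows "add x h \<in> X closure_of S"
proof -
  have xX: "x \<in> topspace X"
    using x by (simp add: in_closure_of)
  have "continuous_map X X (\<lambda>t. add t h)"
    using h by (intro continuous_add) auto
  have "\<exists>y. y \<in> S \<and> y \<in> T" if "openin X T" "add x h \<in> T" for T
  proof -
    have "openin X {t \<in> topspace X. add t h \<in> T}"
      using \<open>continuous_map X X (\<lambda>t. add t h)\<close> that(1) by (rule openin_continuous_map_preimage)
    moreover have "x \<in> {t \<in> topspace X. add t h \<in> T}"
      using xX that(2) by simp
    ultimately obtain t where "t \<in> S" "add t h \<in> T"
      using closure_of_meets[OF x] by blast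
    then show ?thesis
      using S h by blast
  qed
  then show ?thesis
    using xX h by (auto simp: in_closure_of)
qed

text \<open>A point in the closure of the saturation of \<open>C\<close> can be moved along its coset until it is close
  to \<open>C\<close>. Near the new point, the saturation of \<open>C\<close>
  agrees with the sum of \<open>C\<close> and a compact part of \<open>H\<close>, which is closed.\<close>

lemma closed_map_proj_near_zero:
  assumes K: "compactin X K" "K \<subseteq> H"
    and V: "openin X V" "zero \<in> V" and PV: "P \<subseteq> V"
    and small: "\<And>p v w q. p \<in> V \<Longrightarrow> v \<in> V \<Longrightarrow> w \<in> V \<Longrightarrow> q \<in> V \<Longrightarrow>
      add (neg p) (add v (add (neg w) q)) \<in> H \<Longrightarrow> add (neg p) (add v (add (neg w) q)) \<in> K"
    and C: "closedin X C" "C \<subseteq> P"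
  shows "closedin X {x \<in> topspace X. proj x \<in> proj ` C}"
proof -
  define S where "S = {x \<in> topspace X. proj x \<in> proj ` C}"
  define D where "D = {add c k |c k. c \<in> C \<and> k \<in> K}"
  have VX: "V \<subseteq> topspace X" and CX: "C \<subseteq> topspace X"
    using V C by (simp_all add: openin_subset closedin_subset)
  have SE: "\<exists>c\<in>C. \<exists>h\<in>H. s = add c h" if "s \<in> S" for s
    using that CX unfolding S_def by (auto elim!: coset_eqE)
  have DS: "D \<subseteq> S"
    using CX K by (auto simp: D_def S_def subset_iff)
  have S: "add s h \<in> S" if "s \<in> S" "h \<in> H" for s h
    using that by (auto simp: S_def)
  have "x \<in> S" if x: "x \<in> X closure_of S" for x
  proof -
    have xX: "x \<in> topspace X"
      using x by (simp add: in_closure_of)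
    have "x \<in> (\<lambda>v. add v x) ` V"
      by (rule rev_image_eqI[OF V(2)]) (simp add: xX)
    then have "\<exists>s. s \<in> S \<and> s \<in> (\<lambda>v. add v x) ` V"
      by (rule closure_of_meets[OF x openin_right_translation[OF V(1) xX]])
    then obtain w where w: "w \<in> V" "add w x \<in> S"
      by auto
    then obtain c h where c: "c \<in> C" and h: "h \<in> H" and wx: "add w x = add c h"
      using SE by metis
    have wX: "w \<in> topspace X" and cX: "c \<in> topspace X" and cV: "c \<in> V"
      using w c VX CX C PV by auto
    \<comment> \<open>Removing \<open>h\<close> from \<open>add w x = add c h\<close> before undoing
      \<open>w\<close> gives the point of the coset of \<open>x\<close> that is close to
      \<open>C\<close>; \<open>g\<close> is the gyrated \<open>h\<close> by which it differs from
      \<open>x\<close>.\<close>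
    define x' where "x' = add (neg w) c"
    define g where "g = gyr (neg w) c h"
    have x'X: "x' \<in> topspace X"
      using wX cX by (simp add: x'_def)
    have g: "g \<in> H"
      unfolding g_def using sub_gyr[of "neg w" c] wX cX h by auto
    have "x = add (neg w) (add c h)"
      using left_cancel[OF wX xX] wx by simp
    then have x_eq: "x = add x' g"
      using gyr_assoc[of "neg w" c h] wX cX h by (simp add: x'_def g_def)
    \<comment> \<open>A point of \<open>S\<close> near \<open>x'\<close> has the form
      \<open>add v x' = add c' k\<close>. Solving for \<open>k\<close> gives exactly the expression
      in \<open>small\<close>, so \<open>k\<close> is in \<open>K\<close>.\<close>
    have "x' \<in> X closure_of D"
      unfolding in_closure_of
    proof (intro conjI allI impI x'X)
      fix T assume T: "x' \<in> T \<and> openin X T"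
      have "proj x = proj x'"
        using x_eq g x'X by simp
      then obtain h' where h': "h' \<in> H" "x' = add x h'"
        using coset_eqE[of x' x] x'X xX by metis
      have "x' \<in> X closure_of S"
        unfolding h'(2) using S x h'(1) by (rule closure_of_saturated)
      moreover have "openin X (T \<inter> (\<lambda>v. add v x') ` V)"
        using T openin_right_translation[OF V(1) x'X] by (simp add: openin_Int)
      moreover have "x' \<in> T \<inter> (\<lambda>v. add v x') ` V"
        using T by (auto intro!: rev_image_eqI[OF V(2)] simp: x'X)
      ultimately have "\<exists>s. s \<in> S \<and> s \<in> T \<inter> (\<lambda>v. add v x') ` V"
        by (rule closure_of_meets)
      then obtain v where v: "v \<in> V" "add v x' \<in> S" "add v x' \<in> T"
        by auto
      then obtain c' k where c': "c' \<in> C" "k \<in> H" "add v x' = add c' k"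
        using SE by metis
      have c'X: "c' \<in> topspace X" and c'V: "c' \<in> V"
        using c' CX C PV by auto
      have "k = add (neg c') (add v (add (neg w) c))"
        using left_cancel[of c' k] c' c'X by (simp add: x'_def)
      then have "k \<in> K"
        using small[OF c'V v(1) w(1) cV] c'(2) by simp
      then have "add v x' \<in> D"
        using c' by (auto simp: D_def)
      then show "\<exists>y. y \<in> D \<and> y \<in> T"
        using v by blast
    qed
    moreover have "closedin X D"
      unfolding D_def using C(1) K(1) by (rule closedin_add_compact)
    ultimately have "x' \<in> D"
      by (simp add: closure_of_closedin)
    then have "x' \<in> S"
      using DS by blast
    then show "x \<in> S"
      unfolding x_eq using g by (rule S)
  qed
  then have "X closure_of S \<subseteq> S"
    by blast
  moreover have "S \<subseteq> topspace X"
    by (auto simp: S_def)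
  ultimately show ?thesis
    unfolding S_def[symmetric] by (simp add: closure_of_subset_eq[symmetric])
qed

text \<open>If \<open>p\<close> is a point of \<open>P\<close> in the coset, every other such point
  is \<open>add p h\<close> with \<open>h\<close> in \<open>K\<close>, so the fibre is a translate
  of a closed part of \<open>K\<close>.\<close>

lemma compactin_coset_near_zero:
  assumes K: "compactin X K" "K \<subseteq> H"
    and small: "\<And>p q. p \<in> P \<Longrightarrow> q \<in> P \<Longrightarrow> add (neg p) q \<in> H \<Longrightarrow> add (neg p) q \<in> K"
    and P: "closedin X P" and a: "a \<in> topspace X"
  shows "compactin X {x \<in> P. proj x = proj a}"
proof (cases "{x \<in> P. proj x = proj a} = {}")
  case False
  then obtain p where p: "p \<in> P" "proj p = proj a"
    by auto
  have PX: "P \<subseteq> topspace X"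
    using P by (rule closedin_subset)
  have pX: "p \<in> topspace X"
    using p PX by auto
  define Q where "Q = {x \<in> topspace X. add p x \<in> P}"
  have "closedin X Q"
    unfolding Q_def using continuous_left_translation[OF pX] P by (rule closedin_continuous_map_preimage)
  then have "compactin X (K \<inter> Q)"
    using K(1) by (simp add: compact_Int_closedin)
  then have "compactin X (add p ` (K \<inter> Q))"
    using continuous_left_translation[OF pX] by (rule image_compactin)
  moreover have "add p ` (K \<inter> Q) = {x \<in> P. proj x = proj a}"
  proof (intro set_eqI iffI)
    fix x assume "x \<in> add p ` (K \<inter> Q)"
    then show "x \<in> {x \<in> P. proj x = proj a}"
      using K(2) p pX by (auto simp: Q_def)
  next
    fix x assume x: "x \<in> {x \<in> P. proj x = proj a}"
    then have xX: "x \<in> topspace X"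
      using PX by auto
    have "proj x = proj p"
      using x p by simp
    then obtain h where h: "h \<in> H" "x = add p h"
      using coset_eqE[OF xX pX] by metis
    have "add (neg p) x = h"
      unfolding h(2) using pX h(1) by simp
    then have "h \<in> K"
      using small[OF p(1), of x] x h(1) by simp
    moreover have "h \<in> Q"
      using h x by (simp add: Q_def)
    ultimately show "x \<in> add p ` (K \<inter> Q)"
      using h(2) by blast
  qed
  ultimately show ?thesis
    by simp
next
  case True
  then show ?thesis
    by (simp only: compactin_empty)
qed

lemma perfect_neighbourhood:
  assumes "locally_compact_space (subtopology X H)"
  obtains U P where "openin X U" "zero \<in> U" "U \<subseteq> P" "closedin X P"
    "proper_map (subtopology X P) (coset_space X add H) proj"
proof -
  have "zero \<in> topspace (subtopology X H)"
    by simp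
  then obtain N K where "openin (subtopology X H) N" and K': "compactin (subtopology X H) K"
      and N: "zero \<in> N" "N \<subseteq> K"
    using assms unfolding locally_compact_space_def by blast
  then obtain W where W: "openin X W" "N = W \<inter> H"
    by (auto simp: openin_subtopology)
  have K: "compactin X K" "K \<subseteq> H"
    using K' by (auto simp: compactin_subtopology)
  have "zero \<in> W"
    using W N by auto
  \<comment> \<open>The neighbourhoods are chosen from the outside in: \<open>V1\<close> controls
    the outer left difference in \<open>small\<close>, \<open>V2\<close> the sum with
    \<open>v\<close>, and \<open>V3\<close> the inner left difference.\<close>
  obtain V1 where V1: "openin X V1" "zero \<in> V1"
    and V1W: "\<And>x y. x \<in> V1 \<Longrightarrow> y \<in> V1 \<Longrightarrow> add (neg x) y \<in> W"
    by (rule nbhd_zero_left_diff[OF W(1) \<open>zero \<in> W\<close>]) (rule that)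
  obtain V2 where V2: "openin X V2" "zero \<in> V2"
    and V2V1: "\<And>x y. x \<in> V2 \<Longrightarrow> y \<in> V2 \<Longrightarrow> add x y \<in> V1"
    by (rule nbhd_zero_binary[OF add_continuous _ V1]) (simp, rule that)
  obtain V3 where V3: "openin X V3" "zero \<in> V3"
    and V3V2: "\<And>x y. x \<in> V3 \<Longrightarrow> y \<in> V3 \<Longrightarrow> add (neg x) y \<in> V2"
    by (rule nbhd_zero_left_diff[OF V2]) (rule that)
  define V where "V = V1 \<inter> V2 \<inter> V3"
  have V: "openin X V" "zero \<in> V"
    using V1 V2 V3 by (auto simp: V_def)
  obtain U P where UP: "openin X U" "closedin X P" "zero \<in> U" "U \<subseteq> P" "P \<subseteq> V"
    using regular V unfolding neighbourhood_base_of_closedin[symmetric] neighbourhood_base_of by metis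
  have PX: "P \<subseteq> topspace X"
    using UP(2) by (rule closedin_subset)
  have small: "add (neg p) (add v (add (neg w) q)) \<in> K"
    if "p \<in> V" "v \<in> V" "w \<in> V" "q \<in> V" "add (neg p) (add v (add (neg w) q)) \<in> H" for p v w q
  proof -
    have "add (neg p) (add v (add (neg w) q)) \<in> W"
      using that by (intro V1W V2V1 V3V2) (auto simp: V_def)
    then show ?thesis
      using that(5) N W(2) by blast
  qed
  have small': "add (neg p) q \<in> K" if "p \<in> P" "q \<in> P" "add (neg p) q \<in> H" for p q
  proof -
    have "p \<in> V1" "q \<in> V1"
      using that UP(5) by (auto simp: V_def)
    then have "add (neg p) q \<in> W"
      by (rule V1W)
    then show ?thesis
      using that(3) N W(2) by blast
  qed
  have "proper_map (subtopology X P) (coset_space X add H) proj"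
    unfolding proper_map_def
  proof (intro conjI ballI)
    show "closed_map (subtopology X P) (coset_space X add H) proj"
      unfolding closed_map_def
    proof (intro allI impI)
      fix C assume "closedin (subtopology X P) C"
      then have C: "closedin X C" "C \<subseteq> P"
        using UP(2) by (auto simp: closedin_closed_subtopology)
      have "closedin X {x \<in> topspace X. proj x \<in> proj ` C}"
        by (rule closed_map_proj_near_zero[OF K V UP(5) small C])
      moreover have "proj ` C \<subseteq> topspace (coset_space X add H)"
        using C PX by (auto simp: coset_space_def)
      ultimately show "closedin (coset_space X add H) (proj ` C)"
        using quotient_map_proj unfolding quotient_map_closedin by blast
    qed
  next
    fix y assume "y \<in> topspace (coset_space X add H)"
    then obtain a where a: "a \<in> topspace X" "y = proj a"
      by (auto simp: coset_space_def)
    have "compactin X {x \<in> P. proj x = y}"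
      unfolding a(2) by (rule compactin_coset_near_zero[OF K small' UP(2) a(1)])
    moreover have "{x \<in> topspace (subtopology X P). proj x = y} = {x \<in> P. proj x = y}"
      using PX by auto
    ultimately show "compactin (subtopology X P) {x \<in> topspace (subtopology X P). proj x = y}"
      by (auto simp: compactin_subtopology)
  qed
  then show ?thesis
    using that UP by blast
qed

text \<open>The fibre is the coset of \<open>a\<close>, the image of \<open>H\<close> under the
  homeomorphism \<open>add a\<close>.\<close>

lemma metrizable_coset:
  assumes M: "metrizable_space (subtopology X H)" and a: "a \<in> topspace X"
  shows "metrizable_space (subtopology X {x \<in> topspace X. proj x = proj a})"
proof -
  have "add a ` H = {x \<in> topspace X. proj x = proj a}"
  proof (intro set_eqI iffI)
    fix x assume "x \<in> {x \<in> topspace X. proj x = proj a}"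
    then show "x \<in> add a ` H"
      using coset_eqE[of x a] a by blast
  qed (use a in auto)
  moreover have "topspace X \<inter> H = H"
    using sub_subset by blast
  ultimately have img: "add a ` (topspace X \<inter> H) = topspace X \<inter> {x \<in> topspace X. proj x = proj a}"
    by auto
  have "homeomorphic_map X X (add a)"
    using homeomorphic_left_translation[OF a] homeomorphic_map_maps by blast
  then have "homeomorphic_map (subtopology X H) (subtopology X {x \<in> topspace X. proj x = proj a}) (add a)"
    using img by (rule homeomorphic_map_subtopologies)
  then show ?thesis
    using M homeomorphic_metrizable_space homeomorphic_map_imp_homeomorphic_space by blast
qed

end

text \<open>For \<open>b\<close> in the closure of a sequentially closed \<open>A\<close>, translate
  \<open>b\<close> to \<open>zero\<close> and cut the translate of \<open>A\<close> down to
  \<open>P\<close>. The result \<open>B\<close> is sequentially closed in \<open>P\<close>, hence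
  closed, and has \<open>zero\<close> in its closure because \<open>P\<close> contains the
  neighbourhood \<open>U\<close>.\<close>

lemma (in topological_gyrogroup) sequential_space_if_locally_at_zero:
  assumes U: "openin X U" "zero \<in> U" "U \<subseteq> P" and P: "closedin X P"
    and seq: "sequential_space (subtopology X P)"
  shows "sequential_space X"
proof (rule sequential_spaceI)
  fix A assume AX: "A \<subseteq> topspace X"
    and A: "\<And>s x. range s \<subseteq> A \<Longrightarrow> limitin X (s :: nat \<Rightarrow> 'a) x sequentially \<Longrightarrow> x \<in> A"
  have PX: "P \<subseteq> topspace X"
    using P by (rule closedin_subset)
  have "b \<in> A" if b: "b \<in> X closure_of A" for b
  proof -
    have bX: "b \<in> topspace X"
      using b by (simp add: in_closure_of)
    define B where "B = {x \<in> topspace X. add b x \<in> A} \<inter> P"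
    have "closedin (subtopology X P) B"
    proof (rule sequential_spaceD[OF seq])
      fix s x assume s: "range s \<subseteq> B" and lim: "limitin (subtopology X P) (s :: nat \<Rightarrow> 'a) x sequentially"
      have lim': "limitin X s x sequentially" and "x \<in> P"
        using lim by (simp_all add: limitin_subtopology)
      then have "limitin X (add b \<circ> s) (add b x) sequentially"
        using continuous_left_translation[OF bX] by (intro continuous_map_limit)
      moreover have "range (add b \<circ> s) \<subseteq> A"
        using s by (auto simp: B_def)
      ultimately have "add b x \<in> A"
        by (intro A)
      then show "x \<in> B"
        using \<open>x \<in> P\<close> PX by (auto simp: B_def)
    qed (auto simp: B_def)
    then have "closedin X B"
      using P by (simp add: closedin_closed_subtopology)
    moreover have "zero \<in> X closure_of B"
      unfolding in_closure_of
    proof (intro conjI allI impI)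
      fix T assume T: "zero \<in> T \<and> openin X T"
      define R where "R = {z \<in> topspace X. add (neg b) z \<in> T \<inter> U}"
      have "openin X R"
        unfolding R_def using continuous_left_translation[of "neg b"] bX T U
        by (intro openin_continuous_map_preimage) auto
      moreover have "b \<in> R"
        using bX T U by (simp add: R_def)
      ultimately obtain z where "z \<in> A" "z \<in> R"
        using closure_of_meets[OF b] by blast
      then have "add (neg b) z \<in> B" "add (neg b) z \<in> T"
        using bX U by (auto simp: B_def R_def)
      then show "\<exists>y. y \<in> B \<and> y \<in> T"
        by blast
    qed simp
    ultimately have "zero \<in> B"
      by (simp add: closure_of_closedin)
    then show "b \<in> A"
      using bX by (simp add: B_def)
  qed
  then show "closedin X A"
    using AX by (simp add: closure_of_subset_eq[symmetric] subsetI)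
qed

theorem theorem5p6:
  fixes X :: "'a topology"
    and add :: "'a \<Rightarrow> 'a \<Rightarrow> 'a"
    and gyr :: "'a \<Rightarrow> 'a \<Rightarrow> 'a \<Rightarrow> 'a"
    and H :: "'a set"
  assumes "strongly_topological_gyrogroup X add gyr"
    and "strong_subgyrogroup H (topspace X) add gyr"
    and "locally_compact_space (subtopology X H)"
    and "metrizable_space (subtopology X H)"
    and "sequential_space (coset_space X add H)"
  shows "sequential_space X"
proof -
  interpret strongly_topological_gyrogroup X add gyr
    by (rule assms(1))
  interpret topological_gyrogroup_coset X add gyr H
    by unfold_locales (rule assms(2))
  obtain U P where U: "openin X U" "zero \<in> U" "U \<subseteq> P" and P: "closedin X P"
    and proper: "proper_map (subtopology X P) (coset_space X add H) proj"
    by (rule perfect_neighbourhood[OF assms(3)])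
  \<comment> \<open>The fibres of the restricted projection are subspaces of cosets and inherit
    their metrizability.\<close>
  have "metrizable_space (subtopology (subtopology X P) {x \<in> topspace (subtopology X P). proj x = y})"
    if "y \<in> topspace (coset_space X add H)" for y
  proof -
    obtain a where a: "a \<in> topspace X" "y = proj a"
      using \<open>y \<in> topspace (coset_space X add H)\<close> by (auto simp: coset_space_def)
    have "P \<inter> {x \<in> topspace (subtopology X P). proj x = y} = {x \<in> topspace X. proj x = proj a} \<inter> P"
      using a by auto
    then show ?thesis
      using metrizable_space_subtopology[OF metrizable_coset[OF assms(4) a(1)], of P]
      by (simp add: subtopology_subtopology)
  qed
  moreover have "continuous_map (subtopology X P) (coset_space X add H) proj"
    using quotient_map_proj by (intro continuous_map_from_subtopology quotient_imp_continuous_map)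
  ultimately have "sequential_space (subtopology X P)"
    by (intro sequential_space_proper_map_preimage[OF proper] regular_space_subtopology regular assms(5))
  then show ?thesis
    by (rule sequential_space_if_locally_at_zero[OF U P])
qed

end
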